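(* Let $0\le r\le k\le n$ be integers. Then $$\{k\}\{k-1\}\cdots\{k-r+1\}\left\{{n\atop k}\right\}=\{n-k+r\}\{n-k+r-1\}\cdots\{n-k+1\}\left\{{n\atop n-k+r}\right\}.$$ In particular, when $r=0$ (empty products being $1$), $$\left\{{n\atop k}\right\}=\left\{{n\atop n-k}\right\}.$$
   Context: Let $s,t$ be indeterminates. The Lucas sequence is $\{0\}=0$, $\{1\}=1$, $\{n\}=s\{n-1\}+t\{n-2\}$ for $n\ge 2$. Put $\{n\}!=\{1\}\{2\}\cdots\{n\}$, with $\{0\}!=1$, and for $0\le k\le n$ define the Lucasnomial $\left\{{n\atop k}\right\}=\frac{\{n\}!}{\{k\}!\,\{n-k\}!}$. *)

theory Defs
  imports "HOL-Computational_Algebra.Computational_Algebra"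
begin

text \<open>
  The ring Z[s,t] is represented as \<^typ>\<open>int poly poly\<close>: the indeterminate s is the variable of
  the inner (coefficient) polynomials and t is the variable of the outer ones.
\<close>

definition indet_s :: "int poly poly" where
  "indet_s = [:[:0, 1:]:]"

definition indet_t :: "int poly poly" where
  "indet_t = [:0, 1:]"

fun lucas :: "nat \<Rightarrow> int poly poly" where
  "lucas 0 = 0"
| "lucas (Suc 0) = 1"
| "lucas (Suc (Suc n)) = indet_s * lucas (Suc n) + indet_t * lucas n"

definition lucas_fact :: "nat \<Rightarrow> int poly poly" where
  "lucas_fact n = (\<Prod>i = 1..n. lucas i)"

text \<open>
  The quotient is taken in the fraction field of Z[s,t], so nothing is presupposed about
  divisibility. It is a genuine quotient: \<^term>\<open>lucas n\<close> is nonzero for positive \<^term>\<open>n\<close>, since it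
  specializes to a Fibonacci number at s = t = 1. Only arguments with \<^prop>\<open>k \<le> n\<close> are meaningful,
  because \<^term>\<open>n - k\<close> is truncated subtraction.
\<close>

definition lucasnomial :: "nat \<Rightarrow> nat \<Rightarrow> int poly poly fract" where
  "lucasnomial n k = to_fract (lucas_fact n) / to_fract (lucas_fact k * lucas_fact (n - k))"

end

theory Submission
  imports Defs
begin

text \<open>
  The product on the left consists of the top \<open>r\<close> factors of \<open>{k}!\<close>, which it cancels in the
  denominator of the Lucasnomial, leaving \<open>{n}! / ({k-r}! {n-k}!)\<close>. This value is symmetric under
  \<open>k \<mapsto> n - k + r\<close>: that substitution sends \<open>k - r\<close> to \<open>n - k\<close> and \<open>n - k\<close> to \<open>k - r\<close>. The
  right-hand side is the left-hand side after the substitution, hence both agree, and \<open>r = 0\<close>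
  gives the symmetry of the Lucasnomials. The cancellation (\<open>falling_mult_lucasnomial\<close>) is
  legitimate because no \<open>{i}\<close> with \<open>i > 0\<close> vanishes (\<open>lucas_nonzero\<close>).
\<close>

text \<open>
  Specializing to \<open>s = t = 1\<close> turns the Lucas sequence into the Fibonacci sequence, whose terms
  are positive from index 1 on; positivity, unlike nonvanishing, passes through the recurrence.
\<close>
lemma poly_lucas_1_1_pos: "n > 0 \<Longrightarrow> poly (poly (lucas n) 1) 1 > 0"
proof (induction n rule: lucas.induct)
  case (3 n)
  then show ?case
    by (cases "n = 0") (simp_all add: indet_s_def indet_t_def)
qed simp_all

lemma lucas_nonzero: "n > 0 \<Longrightarrow> lucas n \<noteq> 0"
  using poly_lucas_1_1_pos[of n] by auto

lemma lucas_fact_Suc: "lucas_fact (Suc n) = lucas (Suc n) * lucas_fact n"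
  by (simp add: lucas_fact_def)

lemma lucas_falling_mult_fact:
  assumes "r \<le> k"
  shows "(\<Prod>i<r. lucas (k - i)) * lucas_fact (k - r) = lucas_fact k"
  using assms
proof (induction r)
  case (Suc r)
  then have "k - r = Suc (k - Suc r)"
    by simp
  then have "lucas_fact (k - r) = lucas (k - r) * lucas_fact (k - Suc r)"
    by (simp add: lucas_fact_Suc)
  with Suc show ?case
    by (simp add: mult.assoc)
qed simp

text \<open>The common value of the two sides of the theorem, in a form that exhibits its symmetry.\<close>
lemma falling_mult_lucasnomial:
  assumes "r \<le> k"
  shows "to_fract (\<Prod>i<r. lucas (k - i)) * lucasnomial n k =
    to_fract (lucas_fact n) / to_fract (lucas_fact (k - r) * lucas_fact (n - k))"
proof -
  let ?p = "\<Prod>i<r. lucas (k - i)"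
  have "?p \<noteq> 0"
    using assms by (auto simp: lucas_nonzero)
  moreover have "lucas_fact k = ?p * lucas_fact (k - r)"
    using lucas_falling_mult_fact[OF assms] by simp
  ultimately show ?thesis
    by (simp add: lucasnomial_def mult.assoc)
qed

theorem proposition3p2:
  fixes r k n :: nat
  assumes "r \<le> k" and "k \<le> n"
  shows "to_fract (\<Prod>i<r. lucas (k - i)) * lucasnomial n k =
           to_fract (\<Prod>i<r. lucas (n - k + r - i)) * lucasnomial n (n - k + r)
         \<and> lucasnomial n k = lucasnomial n (n - k)"
proof -
  have shift: "to_fract (\<Prod>i<q. lucas (k - i)) * lucasnomial n k =
      to_fract (\<Prod>i<q. lucas (n - k + q - i)) * lucasnomial n (n - k + q)" if "q \<le> k" for q
  proof -
    have "n - (n - k + q) = k - q"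
      using that \<open>k \<le> n\<close> by simp
    then show ?thesis
      using falling_mult_lucasnomial[OF that, of n]
        falling_mult_lucasnomial[of q "n - k + q" n]
      by (simp add: mult.commute)
  qed
  show ?thesis
    using shift[OF \<open>r \<le> k\<close>] shift[of 0] by simp
qed

end
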